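(* For every $n\in\mathbb{N}$ and every continuous map $g:\mathrm{S}^n\to\mathbb{R}^n$, there exist antipodal points $t,-t\in\mathrm{S}^n$ with $g(t)=g(-t)$.
   Context: $\mathrm{S}^n=\{t=(t_0,\ldots,t_n)\in\mathbb{R}^{n+1}\mid\sum_{i=0}^nt_i^2=1\}$ with the topology induced from $\mathbb{R}^{n+1}$. *)

theory Defs
  imports "HOL-Analysis.Analysis"
begin

end

theory Submission
  imports Defs "HOL-Homology.Homology"
begin

text \<open>
  If \<open>g t \<noteq> g (- t)\<close> for all \<open>t\<close>, then normalising \<open>g t - g (- t)\<close> gives an odd map from the \<open>n\<close>-sphere
  into its equator; as a self-map of the \<open>n\<close>-sphere it is not surjective and has degree 0. This contradicts
  Borsuk's theorem that odd self-maps of spheres have odd degree. By the library's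
  \<open>Borsuk_odd_mapping_degree_step\<close>, the parity of the degree of an odd map preserving the equator is
  that of its restriction to the equator, so by induction it suffices to deform an odd map through
  nowhere vanishing maps to an odd one that preserves the equator. After a Lipschitz approximation \<open>q\<close>, some line
  \<open>\<real> p\<close> is missed by the image of the equator under \<open>q\<close>; shearing \<open>p\<close> onto the last axis and damping
  the last coordinate by the distance to the equator gives the deformation.
\<close>

section \<open>Radial normalisation onto the sphere\<close>

text \<open>Points of \<open>nsphere m\<close> are sequences indexed by all naturals and supported
  on the indices up to \<open>m\<close>. Cutting the tail off here leaves the values of
  \<open>v\<close> beyond \<open>m\<close> unconstrained.\<close>

definition sphere_normalize :: "nat \<Rightarrow> (nat \<Rightarrow> real) \<Rightarrow> nat \<Rightarrow> real"
  where "sphere_normalize m v = (\<lambda>i. if i \<le> m then v i / sqrt (\<Sum>j\<le>m. (v j)\<^sup>2) else 0)"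

lemma topspace_nsphere: "topspace (nsphere m) = {x. (\<Sum>i\<le>m. (x i)\<^sup>2) = 1 \<and> (\<forall>i>m. x i = 0)}"
  by (simp add: nsphere)

lemma uminus_in_topspace_nsphere [simp]:
  "(\<lambda>i. - x i) \<in> topspace (nsphere m) \<longleftrightarrow> x \<in> topspace (nsphere m)"
  by (simp add: topspace_nsphere)

lemma sum_squares_pos:
  assumes "i \<le> m" "v i \<noteq> (0::real)"
  shows "(\<Sum>j\<le>(m::nat). (v j)\<^sup>2) > 0"
  using assms by (intro sum_pos2[of _ i]) auto

lemma sphere_normalize_in_nsphere:
  assumes "\<exists>i\<le>m. v i \<noteq> 0"
  shows "sphere_normalize m v \<in> topspace (nsphere m)"
proof -
  have "(\<Sum>j\<le>m. (v j)\<^sup>2) > 0"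
    using assms sum_squares_pos by blast
  then show ?thesis
    by (simp add: topspace_nsphere sphere_normalize_def power_divide real_sqrt_pow2 less_imp_le flip: sum_divide_distrib)
qed

lemma sphere_normalize_uminus: "sphere_normalize m (\<lambda>i. - v i) = (\<lambda>i. - sphere_normalize m v i)"
  by (auto simp: sphere_normalize_def)

lemma sphere_normalize_id: "x \<in> topspace (nsphere m) \<Longrightarrow> sphere_normalize m x = x"
  by (auto simp: sphere_normalize_def topspace_nsphere)

lemma continuous_map_sphere_normalize:
  assumes cont: "\<And>i. i \<le> m \<Longrightarrow> continuous_map X euclideanreal (\<lambda>x. u x i)"
    and nz: "\<And>x. x \<in> topspace X \<Longrightarrow> \<exists>i\<le>m. u x i \<noteq> 0"
  shows "continuous_map X (nsphere m) (\<lambda>x. sphere_normalize m (u x))"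
proof -
  have ss: "(\<Sum>j\<le>m. (u x j)\<^sup>2) > 0" if "x \<in> topspace X" for x
    using nz[OF that] sum_squares_pos by blast
  have "continuous_map X euclideanreal (\<lambda>x. sphere_normalize m (u x) i)" for i
  proof (cases "i \<le> m")
    case True
    have "continuous_map X euclideanreal (\<lambda>x. u x i / sqrt (\<Sum>j\<le>m. (u x j)\<^sup>2))"
    proof (intro continuous_map_real_divide continuous_map_sqrt continuous_map_sum continuous_map_real_pow)
      show "sqrt (\<Sum>j\<le>m. (u x j)\<^sup>2) \<noteq> 0" if "x \<in> topspace X" for x
        using ss[OF that] by simp
    qed (use cont True in auto)
    then show ?thesis
      using True by (simp add: sphere_normalize_def)
  qed (simp add: sphere_normalize_def)
  moreover have "sphere_normalize m (u x) \<in> topspace (nsphere m)" if "x \<in> topspace X" for x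
    using sphere_normalize_in_nsphere nz[OF that] by blast
  ultimately show ?thesis
    by (simp add: nsphere continuous_map_in_subtopology continuous_map_componentwise_UNIV image_subset_iff Pi_iff)
qed

text \<open>The straight-line homotopy is normalised at each time. The hypothesis \<open>nz\<close>
  says that no segment from \<open>u x\<close> to \<open>v x\<close> passes through the
  origin.\<close>

lemma homotopic_with_sphere_normalize:
  assumes u: "\<And>i. i \<le> m \<Longrightarrow> continuous_map X euclideanreal (\<lambda>x. u x i)"
    and v: "\<And>i. i \<le> m \<Longrightarrow> continuous_map X euclideanreal (\<lambda>x. v x i)"
    and nz: "\<And>x t. \<lbrakk>x \<in> topspace X; 0 \<le> t; t \<le> 1\<rbrakk> \<Longrightarrow> \<exists>i\<le>m. (1 - t) * u x i + t * v x i \<noteq> 0"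
  shows "homotopic_with (\<lambda>_. True) X (nsphere m)
           (\<lambda>x. sphere_normalize m (u x)) (\<lambda>x. sphere_normalize m (v x))"
proof -
  let ?P = "prod_topology (top_of_set {0..1::real}) X"
  let ?h = "\<lambda>z i. (1 - fst z) * u (snd z) i + fst z * v (snd z) i"
  have fst: "continuous_map ?P euclideanreal fst"
    using continuous_map_fst continuous_map_into_fulltopology by blast
  have "continuous_map ?P (nsphere m) (\<lambda>z. sphere_normalize m (?h z))"
  proof (rule continuous_map_sphere_normalize)
    fix i assume "i \<le> m"
    show "continuous_map ?P euclideanreal (\<lambda>z. ?h z i)"
      using continuous_map_compose[OF continuous_map_snd u[OF \<open>i \<le> m\<close>], of "top_of_set {0..1::real}"]
        continuous_map_compose[OF continuous_map_snd v[OF \<open>i \<le> m\<close>], of "top_of_set {0..1::real}"]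
      by (intro continuous_map_add continuous_map_real_mult continuous_map_diff fst) (auto simp: o_def)
  next
    fix z assume "z \<in> topspace ?P"
    then show "\<exists>i\<le>m. ?h z i \<noteq> 0"
      using nz[of "snd z" "fst z"] by (auto simp: mem_Times_iff)
  qed
  then show ?thesis
    unfolding homotopic_with_def by (intro exI[of _ "\<lambda>z. sphere_normalize m (?h z)"]) simp
qed

section \<open>Compactness of the sphere and odd Lipschitz approximation\<close>

text \<open>If all \<open>m + 1\<close> coordinates were smaller than \<open>1 / (m + 1)\<close>, so
  would be their squares, which then could not add up to 1. The bound is not sharp, but it measures
  the distance from the origin coordinatewise, as the approximation argument requires.\<close>

lemma nsphere_large_coordinate:
  assumes "x \<in> topspace (nsphere m)"
  shows "\<exists>i\<le>m. \<bar>x i\<bar> \<ge> 1 / real (Suc m)"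
proof (rule ccontr)
  assume small: "\<not> ?thesis"
  have "(x i)\<^sup>2 < 1 / real (Suc m)" if "i \<le> m" for i
  proof -
    have "\<bar>x i\<bar> < 1 / real (Suc m)"
      using small that by force
    moreover have "1 / real (Suc m) \<le> 1"
      by simp
    ultimately have "\<bar>x i\<bar> \<le> 1"
      by linarith
    then have "\<bar>x i\<bar> * \<bar>x i\<bar> \<le> \<bar>x i\<bar> * 1"
      by (intro mult_left_mono) auto
    then show ?thesis
      using \<open>\<bar>x i\<bar> < 1 / real (Suc m)\<close> by (simp add: power2_eq_square)
  qed
  then have "(\<Sum>i\<le>m. (x i)\<^sup>2) < (\<Sum>i\<le>m. 1 / real (Suc m))"
    by (intro sum_strict_mono) auto
  then show False
    using assms by (simp add: topspace_nsphere)
qed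

lemma nsphere_abs_le_1: "x \<in> topspace (nsphere m) \<Longrightarrow> \<bar>x i\<bar> \<le> 1"
  using topspace_nsphere_1[of x m i] by (simp add: abs_square_le_1)

text \<open>The ambient space is an infinite product, so Heine-Borel is replaced by Tychonoff: the
  sphere is a closed subset of the compact cube of sequences with values in [-1, 1].\<close>

lemma compact_topspace_nsphere: "compact (topspace (nsphere m))"
proof -
  have "topspace (nsphere m) = (\<Pi>\<^sub>E i\<in>UNIV. {-1..1}) \<inter> {x. (\<Sum>i\<le>m. (x i)\<^sup>2) = 1 \<and> (\<forall>i>m. x i = 0)}"
    using nsphere_abs_le_1[of _ m] by (fastforce simp: topspace_nsphere abs_le_iff)
  moreover have "compact (\<Pi>\<^sub>E i\<in>(UNIV::nat set). {-1..1::real})"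
    using compactin_PiE[of "\<lambda>_::nat. euclideanreal" UNIV "\<lambda>_. {-1..1}"]
    by (simp add: euclidean_product_topology)
  moreover have "closed {x::nat\<Rightarrow>real. (\<Sum>i\<le>m. (x i)\<^sup>2) = 1 \<and> (\<forall>i>m. x i = 0)}"
    by (intro closed_Collect_conj closed_Collect_all closed_Collect_imp closed_Collect_eq open_Collect_const
        continuous_intros) auto
  ultimately show ?thesis
    by (simp add: compact_Int_closed)
qed

lemma continuous_map_nsphere_real:
  "continuous_map (nsphere m) euclideanreal F \<longleftrightarrow> continuous_on (topspace (nsphere m)) F"
  by (simp add: nsphere euclidean_product_topology)

text \<open>Stone-Weierstrass applies to the algebra of Lipschitz functions on the compact sphere:
  it contains the constants, and the coordinate functions separate points.\<close>

lemma nsphere_lipschitz_approximation: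
  assumes "continuous_map (nsphere m) euclideanreal F" "e > 0"
  shows "\<exists>G. continuous_map (nsphere m) euclideanreal G \<and>
    (\<exists>L\<ge>0. \<forall>x\<in>topspace (nsphere m). \<forall>y\<in>topspace (nsphere m).
       \<bar>G x - G y\<bar> \<le> L * (\<Sum>j\<le>m. \<bar>x j - y j\<bar>)) \<and>
    (\<forall>x\<in>topspace (nsphere m). \<bar>F x - G x\<bar> < e)"
proof -
  let ?S = "topspace (nsphere m)"
  \<comment> \<open>The bound \<open>B\<close> is carried along because the Lipschitz constant of a
    product depends on the sup bounds of its factors.\<close>
  define P :: "((nat \<Rightarrow> real) \<Rightarrow> real) \<Rightarrow> bool" where
    "P G \<longleftrightarrow> continuous_on ?S G \<and> (\<exists>B\<ge>0. \<forall>x\<in>?S. \<bar>G x\<bar> \<le> B) \<and>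
       (\<exists>L\<ge>0. \<forall>x\<in>?S. \<forall>y\<in>?S. \<bar>G x - G y\<bar> \<le> L * (\<Sum>j\<le>m. \<bar>x j - y j\<bar>))" for G
  have "\<exists>G. P G \<and> (\<forall>x\<in>?S. \<bar>F x - G x\<bar> < e)"
  proof (rule Stone_Weierstrass_HOL[OF compact_topspace_nsphere])
    show "P (\<lambda>x. c)" for c
      unfolding P_def by (force intro: exI[of _ "\<bar>c\<bar>"] exI[of _ 0])
    show "continuous_on ?S G" if "P G" for G
      using that by (simp add: P_def)
    show "P (\<lambda>x. f x + g x)" if "P f \<and> P g" for f g
    proof -
      from that have "P f" "P g"
        by auto
      from \<open>P f\<close> obtain B L where f: "B \<ge> 0" "\<And>x. x \<in> ?S \<Longrightarrow> \<bar>f x\<bar> \<le> B" "L \<ge> 0"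
          "\<And>x y. \<lbrakk>x\<in>?S; y\<in>?S\<rbrakk> \<Longrightarrow> \<bar>f x - f y\<bar> \<le> L * (\<Sum>j\<le>m. \<bar>x j - y j\<bar>)"
        unfolding P_def by blast
      from \<open>P g\<close> obtain C M where g: "C \<ge> 0" "\<And>x. x \<in> ?S \<Longrightarrow> \<bar>g x\<bar> \<le> C" "M \<ge> 0"
          "\<And>x y. \<lbrakk>x\<in>?S; y\<in>?S\<rbrakk> \<Longrightarrow> \<bar>g x - g y\<bar> \<le> M * (\<Sum>j\<le>m. \<bar>x j - y j\<bar>)"
        unfolding P_def by blast
      have "\<bar>(f x + g x) - (f y + g y)\<bar> \<le> (L + M) * (\<Sum>j\<le>m. \<bar>x j - y j\<bar>)" if "x\<in>?S" "y\<in>?S" for x y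
        using f(4)[OF that] g(4)[OF that] by (simp add: distrib_right)
      moreover have "\<bar>f x + g x\<bar> \<le> B + C" if "x\<in>?S" for x
        using f(2)[OF that] g(2)[OF that] by simp
      moreover have "continuous_on ?S (\<lambda>x. f x + g x)"
        using that by (auto simp: P_def intro: continuous_intros)
      ultimately show ?thesis
        unfolding P_def using add_nonneg_nonneg[OF f(1) g(1)] add_nonneg_nonneg[OF f(3) g(3)] by blast
    qed
    show "P (\<lambda>x. f x * g x)" if "P f \<and> P g" for f g
    proof -
      from that have "P f" "P g"
        by auto
      from \<open>P f\<close> obtain B L where f: "B \<ge> 0" "\<And>x. x \<in> ?S \<Longrightarrow> \<bar>f x\<bar> \<le> B" "L \<ge> 0"
          "\<And>x y. \<lbrakk>x\<in>?S; y\<in>?S\<rbrakk> \<Longrightarrow> \<bar>f x - f y\<bar> \<le> L * (\<Sum>j\<le>m. \<bar>x j - y j\<bar>)"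
        unfolding P_def by blast
      from \<open>P g\<close> obtain C M where g: "C \<ge> 0" "\<And>x. x \<in> ?S \<Longrightarrow> \<bar>g x\<bar> \<le> C" "M \<ge> 0"
          "\<And>x y. \<lbrakk>x\<in>?S; y\<in>?S\<rbrakk> \<Longrightarrow> \<bar>g x - g y\<bar> \<le> M * (\<Sum>j\<le>m. \<bar>x j - y j\<bar>)"
        unfolding P_def by blast
      have "\<bar>f x * g x - f y * g y\<bar> \<le> (B * M + L * C) * (\<Sum>j\<le>m. \<bar>x j - y j\<bar>)" if "x\<in>?S" "y\<in>?S" for x y
      proof -
        have "f x * g x - f y * g y = f x * (g x - g y) + (f x - f y) * g y"
          by (simp add: algebra_simps)
        then have "\<bar>f x * g x - f y * g y\<bar> \<le> \<bar>f x\<bar> * \<bar>g x - g y\<bar> + \<bar>f x - f y\<bar> * \<bar>g y\<bar>"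
          by (metis abs_mult abs_triangle_ineq)
        also have "\<dots> \<le> B * (M * (\<Sum>j\<le>m. \<bar>x j - y j\<bar>)) + (L * (\<Sum>j\<le>m. \<bar>x j - y j\<bar>)) * C"
          using f g that by (intro add_mono mult_mono) (auto intro!: mult_nonneg_nonneg sum_nonneg)
        finally show ?thesis
          by (simp add: algebra_simps)
      qed
      moreover have "\<bar>f x * g x\<bar> \<le> B * C" if "x\<in>?S" for x
        using f g that by (auto simp: abs_mult intro: mult_mono)
      moreover have "continuous_on ?S (\<lambda>x. f x * g x)"
        using that by (auto simp: P_def intro: continuous_intros)
      moreover have "B * M + L * C \<ge> 0" "B * C \<ge> 0"
        using f(1,3) g(1,3) by auto
      ultimately show ?thesis
        unfolding P_def by blast
    qed
    show "\<exists>G. P G \<and> G x \<noteq> G y" if xy: "x \<in> ?S \<and> y \<in> ?S \<and> x \<noteq> y" for x y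
    proof -
      obtain k where k: "x k \<noteq> y k"
        using xy by blast
      then have "k \<le> m"
        using xy by (force simp: topspace_nsphere)
      then have "\<bar>x k - y k\<bar> \<le> 1 * (\<Sum>j\<le>m. \<bar>x j - y j\<bar>)" for x y :: "nat \<Rightarrow> real"
        using member_le_sum[of k "{..m}" "\<lambda>j. \<bar>x j - y j\<bar>"] by simp
      moreover have "continuous_on ?S (\<lambda>x. x k)"
        using continuous_map_nsphere_projection continuous_map_nsphere_real by blast
      ultimately have "P (\<lambda>x. x k)"
        unfolding P_def using nsphere_abs_le_1[of _ m k] zero_le_one[where 'a=real] by blast
      with k show ?thesis
        by blast
    qed
    show "continuous_on ?S F"
      using assms by (simp add: continuous_map_nsphere_real)
  qed (fact \<open>e > 0\<close>)
  then show ?thesis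
    unfolding P_def continuous_map_nsphere_real by blast
qed

lemma continuous_map_nsphere_uminus: "continuous_map (nsphere m) (nsphere m) (\<lambda>x i. - x i)"
proof -
  have "continuous_map (nsphere m) euclideanreal (\<lambda>x. - x i)" for i
    by (intro continuous_map_minus continuous_map_nsphere_projection)
  moreover have "(\<lambda>x i. - x i) \<in> topspace (nsphere m) \<rightarrow> topspace (nsphere m)"
    by simp
  ultimately show ?thesis
    by (simp add: nsphere continuous_map_in_subtopology continuous_map_componentwise_UNIV)
qed

lemma nsphere_odd_lipschitz_approximation:
  assumes f: "continuous_map (nsphere m) (nsphere m) f"
    and odd: "\<And>x. x \<in> topspace (nsphere m) \<Longrightarrow> f (\<lambda>i. - x i) = (\<lambda>i. - f x i)"
    and "e > 0"
  obtains q L where "\<And>i. i \<le> m \<Longrightarrow> continuous_map (nsphere m) euclideanreal (\<lambda>x. q x i)" "0 \<le> L"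
    "\<And>x y i. \<lbrakk>x \<in> topspace (nsphere m); y \<in> topspace (nsphere m); i \<le> m\<rbrakk>
       \<Longrightarrow> \<bar>q x i - q y i\<bar> \<le> L * (\<Sum>j\<le>m. \<bar>x j - y j\<bar>)"
    "\<And>x i. \<lbrakk>x \<in> topspace (nsphere m); i \<le> m\<rbrakk> \<Longrightarrow> \<bar>f x i - q x i\<bar> < e"
    "\<And>x i. q (\<lambda>i. - x i) i = - q x i"
proof -
  let ?S = "topspace (nsphere m)"
  have fi: "continuous_map (nsphere m) euclideanreal (\<lambda>x. f x i)" for i
    using continuous_map_compose[OF f continuous_map_nsphere_projection[of m i]] by (simp add: o_def)
  have "\<forall>i. \<exists>G. continuous_map (nsphere m) euclideanreal G \<and>
      (\<exists>L\<ge>0. \<forall>x\<in>?S. \<forall>y\<in>?S. \<bar>G x - G y\<bar> \<le> L * (\<Sum>j\<le>m. \<bar>x j - y j\<bar>)) \<and>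
      (\<forall>x\<in>?S. \<bar>f x i - G x\<bar> < e)"
    using nsphere_lipschitz_approximation[OF fi \<open>e > 0\<close>] by blast
  from choice[OF this] obtain G where G: "\<And>i. continuous_map (nsphere m) euclideanreal (G i)"
    and "\<forall>i. \<exists>L\<ge>0. \<forall>x\<in>?S. \<forall>y\<in>?S. \<bar>G i x - G i y\<bar> \<le> L * (\<Sum>j\<le>m. \<bar>x j - y j\<bar>)"
    and e: "\<And>i x. x \<in> ?S \<Longrightarrow> \<bar>f x i - G i x\<bar> < e"
    by blast
  then obtain L where L0: "\<And>i. 0 \<le> L i"
    and L: "\<And>i x y. \<lbrakk>x \<in> ?S; y \<in> ?S\<rbrakk> \<Longrightarrow> \<bar>G i x - G i y\<bar> \<le> L i * (\<Sum>j\<le>m. \<bar>x j - y j\<bar>)"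
    using choice[of "\<lambda>i L. L \<ge> 0 \<and> (\<forall>x\<in>?S. \<forall>y\<in>?S. \<bar>G i x - G i y\<bar> \<le> L * (\<Sum>j\<le>m. \<bar>x j - y j\<bar>))"]
    by blast
  \<comment> \<open>Taking the odd part restores oddness. It does not enlarge the Lipschitz
    constant, and it keeps the error below \<open>e\<close> because \<open>f\<close> is itself
    odd.\<close>
  define q where "q x i = (G i x - G i (\<lambda>i. - x i)) / 2" for x i
  show ?thesis
  proof
    show "continuous_map (nsphere m) euclideanreal (\<lambda>x. q x i)" for i
      unfolding q_def using G continuous_map_compose[OF continuous_map_nsphere_uminus G, of i]
      by (intro continuous_map_real_divide continuous_map_diff) (auto simp: o_def)
    \<comment> \<open>The sum serves as one Lipschitz constant for all coordinates up to
      \<open>m\<close>.\<close>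
    show "0 \<le> (\<Sum>i\<le>m. L i)"
      using L0 by (simp add: sum_nonneg)
    fix x i assume x: "x \<in> ?S" and i: "i \<le> m"
    show "\<bar>f x i - q x i\<bar> < e"
      using e[OF x, of i] e[of "\<lambda>i. - x i" i] x odd[OF x]
      by (simp add: q_def abs_less_iff field_simps)
    fix y assume y: "y \<in> ?S"
    let ?s = "\<Sum>j\<le>m. \<bar>x j - y j\<bar>"
    have half_diff: "\<bar>(a - b) / 2 - (c - d) / 2\<bar> \<le> s" if "\<bar>a - c\<bar> \<le> s" "\<bar>b - d\<bar> \<le> s" for a b c d s :: real
      using that by (simp add: abs_le_iff field_simps)
    have "(\<Sum>j\<le>m. \<bar>- x j - - y j\<bar>) = ?s"
      by (intro sum.cong) auto
    then have "\<bar>G i (\<lambda>i. - x i) - G i (\<lambda>i. - y i)\<bar> \<le> L i * ?s"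
      using L[of "\<lambda>i. - x i" "\<lambda>i. - y i" i] x y by simp
    then have "\<bar>q x i - q y i\<bar> \<le> L i * ?s"
      unfolding q_def by (rule half_diff[OF L[OF x y]])
    also have "\<dots> \<le> (\<Sum>i\<le>m. L i) * ?s"
      using i L0 by (intro mult_right_mono member_le_sum) (auto intro: sum_nonneg)
    finally show "\<bar>q x i - q y i\<bar> \<le> (\<Sum>i\<le>m. L i) * ?s" .
  qed (simp add: q_def field_simps)
qed

section \<open>Dimension drop: Lipschitz images and cones\<close>

text \<open>A grid of \<open>K ^ (m + 1)\<close> points in the image would need preimages lying in different cells of a
  mesh with only \<open>O(K ^ m)\<close> cells.\<close>

lemma lipschitz_image_misses_point:
  fixes Q :: "(nat \<Rightarrow> real) \<Rightarrow> nat \<Rightarrow> real"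
  assumes "0 \<le> L" "0 \<le> B"
    and lip: "\<And>y z i. \<lbrakk>y \<in> Y; z \<in> Y; i \<le> m\<rbrakk> \<Longrightarrow> \<bar>Q y i - Q z i\<bar> \<le> L * (\<Sum>j<m. \<bar>y j - z j\<bar>)"
    and bound: "\<And>y j. \<lbrakk>y \<in> Y; j < m\<rbrakk> \<Longrightarrow> \<bar>y j\<bar> \<le> B"
  shows "\<exists>p. (\<forall>i\<le>m. 1 \<le> p i \<and> p i \<le> 2) \<and> (\<forall>y\<in>Y. \<exists>i\<le>m. Q y i \<noteq> p i)"
proof (rule ccontr)
  assume "\<not> ?thesis"
  then have hit: "\<exists>y\<in>Y. \<forall>i\<le>m. Q y i = p i" if "\<forall>i\<le>m. 1 \<le> p i \<and> p i \<le> 2" for p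
    using that by blast
  \<comment> \<open>Three scales are chosen. With \<open>c > L * m\<close>, moving every coordinate
    by at most \<open>1 / (c * K)\<close> moves the image by less than the grid spacing
    \<open>1 / K\<close>. With \<open>D > 2 * B * c\<close>, each side of the domain meets fewer
    than \<open>D * K\<close> intervals of length \<open>1 / N\<close>. With
    \<open>K > D ^ m\<close>, there are more grid points than cells.\<close>
  obtain c :: nat where c: "L * m < c"
    using reals_Archimedean2 by blast
  then have "c > 0"
    using \<open>0 \<le> L\<close> by (metis gr0I less_le_not_le mult_nonneg_nonneg of_nat_0 of_nat_0_le_iff)
  obtain D :: nat where D: "2 * B * c < D"
    using reals_Archimedean2 by blast
  define K where "K = D ^ m + 1"
  define N where "N = c * K"
  have "K > 0" "N > 0"
    using \<open>c > 0\<close> by (auto simp: K_def N_def)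
  define grid where "grid = (\<Pi>\<^sub>E i\<in>{..m}. {..<K})"
  define cells where "cells = (\<Pi>\<^sub>E j\<in>{..<m}. {..<D * K})"
  have "\<exists>y\<in>Y. \<forall>i\<le>m. Q y i = 1 + real (a i) / K" if "a \<in> grid" for a
  proof (rule hit, intro allI impI)
    fix i assume "i \<le> m"
    then have "real (a i) < K"
      using that by (auto simp: grid_def PiE_iff)
    then show "1 \<le> 1 + real (a i) / K \<and> 1 + real (a i) / K \<le> 2"
      using \<open>K > 0\<close> by simp
  qed
  then obtain y where yY: "\<And>a. a \<in> grid \<Longrightarrow> y a \<in> Y"
    and Qy: "\<And>a i. \<lbrakk>a \<in> grid; i \<le> m\<rbrakk> \<Longrightarrow> Q (y a) i = 1 + real (a i) / K"
    by metis
  \<comment> \<open>The index of the cube of side \<open>1 / N\<close> containing the chosen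
    preimage \<open>y a\<close>. Adding \<open>B\<close> makes the coordinates nonnegative, so
    \<open>nat\<close> loses nothing.\<close>
  define cell where "cell a = (\<lambda>j\<in>{..<m}. nat \<lfloor>N * (y a j + B)\<rfloor>)" for a
  have nonneg: "0 \<le> N * (y a j + B)" if "a \<in> grid" "j < m" for a j
    using bound[OF yY] that by (fastforce simp: abs_le_iff)
  have "cell a \<in> cells" if a: "a \<in> grid" for a
  proof -
    have "nat \<lfloor>N * (y a j + B)\<rfloor> < D * K" if j: "j < m" for j
    proof -
      have "N * (y a j + B) \<le> N * (2 * B)"
        using bound[OF yY[OF a] j] by (intro mult_left_mono) auto
      also have "\<dots> = (2 * B * c) * K"
        by (simp add: N_def)
      also have "\<dots> < real D * K"
        using D \<open>K > 0\<close> by (intro mult_strict_right_mono) auto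
      finally have "N * (y a j + B) < real (D * K)"
        by simp
      then show ?thesis
        using nonneg[OF a j] by linarith
    qed
    then show ?thesis
      by (auto simp: cell_def cells_def)
  qed
  moreover have "inj_on cell grid"
  proof (rule inj_onI)
    fix a b assume a: "a \<in> grid" and b: "b \<in> grid" and eq: "cell a = cell b"
    have close: "\<bar>y a j - y b j\<bar> \<le> 1 / N" if j: "j < m" for j
    proof -
      have "nat \<lfloor>N * (y a j + B)\<rfloor> = nat \<lfloor>N * (y b j + B)\<rfloor>"
        using fun_cong[OF eq, of j] j by (simp add: cell_def)
      then have "\<bar>N * (y a j + B) - N * (y b j + B)\<bar> \<le> 1"
        using nonneg[OF a j] nonneg[OF b j] by linarith
      also have "N * (y a j + B) - N * (y b j + B) = N * (y a j - y b j)"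
        by (simp add: algebra_simps)
      finally show ?thesis
        using \<open>N > 0\<close> by (simp only: abs_mult) (simp add: field_simps)
    qed
    \<comment> \<open>Preimages in the same cell have images less than \<open>1 / K\<close> apart in
      each coordinate, so the integer grid indices agree.\<close>
    have "a i = b i" if i: "i \<le> m" for i
    proof -
      have "\<bar>real (a i) / K - real (b i) / K\<bar> = \<bar>Q (y a) i - Q (y b) i\<bar>"
        using Qy a b i by simp
      also have "\<dots> \<le> L * (\<Sum>j<m. \<bar>y a j - y b j\<bar>)"
        using lip yY a b i by blast
      also have "\<dots> \<le> L * (\<Sum>j<m. 1 / N)"
        using close \<open>0 \<le> L\<close> by (intro mult_left_mono sum_mono) auto
      also have "\<dots> = L * m / (c * K)"
        by (simp add: N_def)
      also have "\<dots> < c / (c * K)"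
        using c \<open>c > 0\<close> \<open>K > 0\<close> by (intro divide_strict_right_mono) auto
      also have "\<dots> = 1 / K"
        using \<open>c > 0\<close> by simp
      finally have "\<bar>real (a i) - real (b i)\<bar> < 1"
        using \<open>K > 0\<close> by (simp add: field_simps flip: diff_divide_distrib)
      then show ?thesis
        by linarith
    qed
    then show "a = b"
      using a b by (intro extensionalityI[of a "{..m}"]) (auto simp: grid_def PiE_def)
  qed
  moreover have "finite cells"
    by (simp add: cells_def finite_PiE)
  ultimately have "card grid \<le> card cells"
    by (meson card_inj_on_le image_subsetI)
  then have "K ^ Suc m \<le> (D * K) ^ m"
    by (simp add: grid_def cells_def card_PiE)
  then have "K * K ^ m \<le> D ^ m * K ^ m"
    by (simp add: power_mult_distrib)
  then show False
    using \<open>K > 0\<close> by (simp add: K_def)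
qed

text \<open>The positively homogeneous extension of \<open>q\<close> from the unit sphere along
  rays. At the origin the factor \<open>L2_set y {..m}\<close> is 0, so the value is 0 whatever
  \<open>q\<close> returns there.\<close>

definition cone_map :: "nat \<Rightarrow> ((nat \<Rightarrow> real) \<Rightarrow> nat \<Rightarrow> real) \<Rightarrow> (nat \<Rightarrow> real) \<Rightarrow> nat \<Rightarrow> real"
  where "cone_map m q y i = L2_set y {..m} * q (\<lambda>j. y j / L2_set y {..m}) i"

text \<open>Let \<open>a\<close>, \<open>b\<close> be the norms of \<open>y\<close>,
  \<open>z\<close> and \<open>u\<close>, \<open>v\<close> their directions. Then
  \<open>a * q u - b * q v = (a - b) * q u + b * (q u - q v)\<close>. The first term costs
  \<open>C * s\<close>. In the second, \<open>b * (u j - v j)\<close> is bounded by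
  \<open>\<bar>y j - z j\<bar> + s\<close>, and summing over \<open>m + 1\<close> coordinates gives
  the factor \<open>m + 2\<close>. Vectors of norm 0 are treated apart, since they have no
  direction.\<close>

lemma cone_map_lipschitz:
  assumes "0 \<le> L" and bound: "\<And>x. x \<in> topspace (nsphere m) \<Longrightarrow> \<bar>q x i\<bar> \<le> C"
    and lip: "\<And>x y. \<lbrakk>x \<in> topspace (nsphere m); y \<in> topspace (nsphere m)\<rbrakk>
       \<Longrightarrow> \<bar>q x i - q y i\<bar> \<le> L * (\<Sum>j\<le>m. \<bar>x j - y j\<bar>)"
    and y: "\<And>j. j > m \<Longrightarrow> y j = 0" and z: "\<And>j. j > m \<Longrightarrow> z j = 0"
  shows "\<bar>cone_map m q y i - cone_map m q z i\<bar> \<le> (C + L * (m + 2)) * (\<Sum>j\<le>m. \<bar>y j - z j\<bar>)"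
proof -
  define s where "s = (\<Sum>j\<le>m. \<bar>y j - z j\<bar>)"
  let ?u = "\<lambda>y j. y j / L2_set y {..m}"
  have s0: "s \<ge> 0"
    by (simp add: s_def sum_nonneg)
  have C0: "C \<ge> 0"
    using bound[OF in_topspace_nsphere] by linarith
  have pos: "L2_set y {..m} > 0" if "L2_set y {..m} \<noteq> 0" for y
    using that by (metis L2_set_nonneg order_le_less)
  have unit: "?u y \<in> topspace (nsphere m)" if "L2_set y {..m} \<noteq> 0" "\<And>j. j > m \<Longrightarrow> y j = 0" for y
    using that by (simp add: topspace_nsphere L2_set_def power_divide sum_nonneg flip: sum_divide_distrib)
  have tri: "L2_set y {..m} - L2_set z {..m} \<le> (\<Sum>j\<le>m. \<bar>y j - z j\<bar>)" for y z
    using L2_set_triangle_ineq[of "\<lambda>j. y j - z j" z "{..m}"] L2_set_le_sum_abs[of "\<lambda>j. y j - z j" "{..m}"]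
    by simp
  have norms: "\<bar>L2_set y {..m} - L2_set z {..m}\<bar> \<le> s"
    using tri[of y z] tri[of z y] by (simp add: s_def abs_minus_commute)
  have mono: "C * s \<le> (C + L * (m + 2)) * s"
    using s0 \<open>0 \<le> L\<close> by (intro mult_right_mono) auto
  consider "L2_set y {..m} = 0" | "L2_set z {..m} = 0" | "L2_set y {..m} \<noteq> 0" "L2_set z {..m} \<noteq> 0"
    by blast
  then have "\<bar>cone_map m q y i - cone_map m q z i\<bar> \<le> (C + L * (m + 2)) * s"
  proof cases
    case 1
    show ?thesis
    proof (cases "L2_set z {..m} = 0")
      case False
      then have "\<bar>cone_map m q z i\<bar> \<le> s * C"
        unfolding cone_map_def abs_mult using norms 1 bound[OF unit[OF False z]] s0
        by (intro mult_mono) auto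
      then show ?thesis
        using 1 mono by (simp add: cone_map_def mult.commute)
    qed (use 1 s0 C0 \<open>0 \<le> L\<close> in \<open>simp add: cone_map_def\<close>)
  next
    case 2
    show ?thesis
    proof (cases "L2_set y {..m} = 0")
      case False
      then have "\<bar>cone_map m q y i\<bar> \<le> s * C"
        unfolding cone_map_def abs_mult using norms 2 bound[OF unit[OF False y]] s0
        by (intro mult_mono) auto
      then show ?thesis
        using 2 mono by (simp add: cone_map_def mult.commute)
    qed (use 2 s0 C0 \<open>0 \<le> L\<close> in \<open>simp add: cone_map_def\<close>)
  next
    case 3
    define a b where "a = L2_set y {..m}" and "b = L2_set z {..m}"
    have ab: "a > 0" "b > 0" "\<bar>a - b\<bar> \<le> s"
      using 3 pos norms by (auto simp: a_def b_def)
    have coord: "b * \<bar>?u y j - ?u z j\<bar> \<le> \<bar>y j - z j\<bar> + s" if "j \<le> m" for j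
    proof -
      have "\<bar>y j\<bar> \<le> a"
        using that member_le_L2_set[of "{..m}" j "\<lambda>j. \<bar>y j\<bar>"] by (simp add: a_def L2_set_def)
      then have "\<bar>y j\<bar> / a \<le> 1"
        using ab by simp
      then have "\<bar>y j\<bar> / a * \<bar>b - a\<bar> \<le> 1 * s"
        using ab by (intro mult_mono) auto
      moreover have "b * (y j / a - z j / b) = (y j - z j) + y j / a * (b - a)"
        using ab by (simp add: field_simps)
      then have "b * \<bar>y j / a - z j / b\<bar> \<le> \<bar>y j - z j\<bar> + \<bar>y j\<bar> / a * \<bar>b - a\<bar>"
        using ab abs_triangle_ineq[of "y j - z j" "y j / a * (b - a)"]
        by (metis abs_divide abs_mult abs_of_pos)
      ultimately show ?thesis
        by (simp add: a_def b_def)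
    qed
    have "b * \<bar>q (?u y) i - q (?u z) i\<bar> \<le> b * (L * (\<Sum>j\<le>m. \<bar>?u y j - ?u z j\<bar>))"
      using lip[OF unit[OF 3(1) y] unit[OF 3(2) z]] ab by (intro mult_left_mono) auto
    also have "\<dots> = L * (\<Sum>j\<le>m. b * \<bar>?u y j - ?u z j\<bar>)"
      by (simp add: sum_distrib_left mult_ac)
    also have "\<dots> \<le> L * (\<Sum>j\<le>m. \<bar>y j - z j\<bar> + s)"
      using coord \<open>0 \<le> L\<close> by (intro mult_left_mono sum_mono) auto
    also have "\<dots> = L * (m + 2) * s"
      by (simp add: sum.distrib s_def[symmetric] algebra_simps)
    finally have 1: "b * \<bar>q (?u y) i - q (?u z) i\<bar> \<le> L * (m + 2) * s" .
    have 2: "\<bar>a - b\<bar> * \<bar>q (?u y) i\<bar> \<le> s * C"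
      using ab bound[OF unit[OF 3(1) y]] s0 by (intro mult_mono) auto
    have "cone_map m q y i - cone_map m q z i = (a - b) * q (?u y) i + b * (q (?u y) i - q (?u z) i)"
      by (simp add: cone_map_def a_def b_def algebra_simps)
    then have "\<bar>cone_map m q y i - cone_map m q z i\<bar>
        \<le> \<bar>a - b\<bar> * \<bar>q (?u y) i\<bar> + b * \<bar>q (?u y) i - q (?u z) i\<bar>"
      using ab by (metis abs_mult abs_of_pos abs_triangle_ineq)
    with 1 2 show ?thesis
      by (simp add: algebra_simps)
  qed
  then show ?thesis
    by (simp add: s_def)
qed

section \<open>Odd self-maps of spheres have odd degree\<close>

text \<open>On the two-point sphere an odd map is either the identity or the antipodal map. The
  latter coincides there with the reflection in coordinate 0, of degree -1.\<close>

lemma odd_degree_nsphere_0: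
  assumes f: "continuous_map (nsphere 0) (nsphere 0) f"
    and odd: "\<And>x. x \<in> topspace (nsphere 0) \<Longrightarrow> f (\<lambda>i. - x i) = (\<lambda>i. - f x i)"
  shows "odd (Brouwer_degree2 0 f)"
proof -
  define e :: "nat \<Rightarrow> real" where "e = (\<lambda>n. if n = 0 then 1 else 0)"
  have e: "e \<in> topspace (nsphere 0)"
    unfolding e_def by (rule in_topspace_nsphere)
  have S0: "x = e \<or> x = (\<lambda>i. - e i)" if "x \<in> topspace (nsphere 0)" for x
    using that by (auto simp: topspace_nsphere e_def fun_eq_iff power2_eq_1_iff)
  have "f e \<in> topspace (nsphere 0)"
    using f e continuous_map_image_subset_topspace by blast
  then consider "f e = e" | "f e = (\<lambda>i. - e i)"
    using S0 by blast
  then show ?thesis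
  proof cases
    case 1
    then have "Brouwer_degree2 0 f = Brouwer_degree2 0 id"
      using S0 odd[OF e] by (intro Brouwer_degree2_eq) force
    then show ?thesis
      by simp
  next
    case 2
    have "Brouwer_degree2 0 f = Brouwer_degree2 0 (\<lambda>x i. if i = 0 then - x i else x i)"
    proof (rule Brouwer_degree2_eq)
      fix x assume "x \<in> topspace (nsphere 0)"
      then have "f x = (\<lambda>i. - x i)"
        using S0[of x] 2 odd[OF e] by auto
      also have "\<dots> = (\<lambda>i. if i = 0 then - x i else x i)"
        using \<open>x \<in> topspace (nsphere 0)\<close> by (auto simp: topspace_nsphere)
      finally show "f x = (\<lambda>i. if i = 0 then - x i else x i)" .
    qed
    then show ?thesis
      by (simp add: Brouwer_degree2_reflection)
  qed
qed

text \<open>The cone over the equator is only \<open>m\<close>-dimensional, so its image under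
  \<open>cone_map\<close> misses some point \<open>p\<close> of the cube with sides [1, 2]. If
  \<open>q x = c * p\<close> held for some \<open>x\<close> on the equator, \<open>p\<close> would
  be the value of the cone map at \<open>x / c\<close>.\<close>

lemma odd_lipschitz_map_misses_line:
  assumes "0 \<le> L" "0 < d"
    and lip: "\<And>x y i. \<lbrakk>x \<in> topspace (nsphere m); y \<in> topspace (nsphere m); i \<le> m\<rbrakk>
       \<Longrightarrow> \<bar>q x i - q y i\<bar> \<le> L * (\<Sum>j\<le>m. \<bar>x j - y j\<bar>)"
    and bound: "\<And>x i. \<lbrakk>x \<in> topspace (nsphere m); i \<le> m\<rbrakk> \<Longrightarrow> \<bar>q x i\<bar> \<le> C"
    and away: "\<And>x. x \<in> topspace (nsphere m) \<Longrightarrow> \<exists>i\<le>m. d \<le> \<bar>q x i\<bar>"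
    and odd: "\<And>x i. q (\<lambda>i. - x i) i = - q x i"
  shows "\<exists>p. (\<forall>i\<le>m. 0 < p i) \<and>
    (\<forall>x\<in>topspace (nsphere m). x m = 0 \<longrightarrow> (\<forall>c. \<exists>i\<le>m. q x i \<noteq> c * p i))"
proof -
  \<comment> \<open>The radius comes from a lower bound on \<open>c\<close>: some coordinate of
    \<open>q x\<close> has size at least \<open>d\<close> and \<open>p i\<close> is at most 2, so
    \<open>\<bar>c\<bar> \<ge> d / 2\<close> and \<open>x / c\<close> has norm at most
    \<open>2 / d\<close>.\<close>
  define Y where "Y = {y. (\<forall>j\<ge>m. y j = 0) \<and> L2_set y {..m} \<le> 2 / d}"
  have C0: "0 \<le> C"
    using bound[OF in_topspace_nsphere, of 0] by linarith
  have "\<exists>p. (\<forall>i\<le>m. 1 \<le> p i \<and> p i \<le> 2) \<and> (\<forall>y\<in>Y. \<exists>i\<le>m. cone_map m q y i \<noteq> p i)"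
  proof (rule lipschitz_image_misses_point)
    show "0 \<le> C + L * (m + 2)" "0 \<le> 2 / d"
      using C0 assms(1,2) by auto
    fix y z i assume yz: "y \<in> Y" "z \<in> Y" and i: "i \<le> m"
    have "\<bar>cone_map m q y i - cone_map m q z i\<bar> \<le> (C + L * (m + 2)) * (\<Sum>j\<le>m. \<bar>y j - z j\<bar>)"
      using yz i by (intro cone_map_lipschitz \<open>0 \<le> L\<close> lip bound) (auto simp: Y_def)
    \<comment> \<open>Coordinate \<open>m\<close> vanishes on \<open>Y\<close>; this is the drop
      from \<open>m + 1\<close> to \<open>m\<close> variables.\<close>
    also have "(\<Sum>j\<le>m. \<bar>y j - z j\<bar>) = (\<Sum>j<m. \<bar>y j - z j\<bar>)"
      using yz by (simp add: Y_def flip: lessThan_Suc_atMost)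
    finally show "\<bar>cone_map m q y i - cone_map m q z i\<bar> \<le> (C + L * (m + 2)) * (\<Sum>j<m. \<bar>y j - z j\<bar>)" .
  next
    fix y j assume "y \<in> Y" "j < m"
    then show "\<bar>y j\<bar> \<le> 2 / d"
      using member_le_L2_set[of "{..m}" j "\<lambda>j. \<bar>y j\<bar>"] by (simp add: Y_def L2_set_def)
  qed
  then obtain p where p: "\<And>i. i \<le> m \<Longrightarrow> 1 \<le> p i \<and> p i \<le> 2"
    and miss: "\<And>y. y \<in> Y \<Longrightarrow> \<exists>i\<le>m. cone_map m q y i \<noteq> p i"
    by metis
  have "\<exists>i\<le>m. q x i \<noteq> c * p i" if x: "x \<in> topspace (nsphere m)" and xm: "x m = 0" for x c
  proof (rule ccontr)
    assume "\<not> ?thesis"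
    then have qx: "q x i = c * p i" if "i \<le> m" for i
      using that by blast
    obtain i where i: "i \<le> m" "d \<le> \<bar>q x i\<bar>"
      using away[OF x] by blast
    have "\<bar>c\<bar> * \<bar>p i\<bar> \<le> \<bar>c\<bar> * 2"
      using p[OF i(1)] by (intro mult_left_mono) auto
    then have c: "d / 2 \<le> \<bar>c\<bar>"
      using i qx by (simp add: abs_mult)
    then have "c \<noteq> 0"
      using \<open>0 < d\<close> by auto
    let ?y = "\<lambda>j. x j / c"
    have norm: "L2_set ?y {..m} = 1 / \<bar>c\<bar>"
      using x by (simp add: topspace_nsphere L2_set_def power_divide real_sqrt_divide flip: sum_divide_distrib)
    have "1 / \<bar>c\<bar> \<le> 2 / d"
      using c \<open>0 < d\<close> \<open>c \<noteq> 0\<close> by (simp add: field_simps)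
    moreover have "\<forall>j\<ge>m. ?y j = 0"
      using x xm by (auto simp: topspace_nsphere le_less)
    ultimately have "?y \<in> Y"
      by (simp add: Y_def norm)
    \<comment> \<open>The direction of \<open>x / c\<close> is \<open>x\<close> or
      \<open>- x\<close> according to the sign of \<open>c\<close>; oddness of \<open>q\<close>
      settles the negative case.\<close>
    moreover have "cone_map m q ?y i = p i" if i: "i \<le> m" for i
    proof (cases "c > 0")
      case True
      then have "(\<lambda>j. ?y j / L2_set ?y {..m}) = x"
        by (simp add: norm)
      then show ?thesis
        using True qx[OF i] by (simp add: cone_map_def norm)
    next
      case False
      then have "(\<lambda>j. ?y j / L2_set ?y {..m}) = (\<lambda>j. - x j)"
        using \<open>c \<noteq> 0\<close> by (simp add: norm)
      then show ?thesis
        using False \<open>c \<noteq> 0\<close> qx[OF i] by (simp add: cone_map_def norm odd)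
    qed
    ultimately show False
      using miss by blast
  qed
  then show ?thesis
    using p by (metis zero_less_one order_less_le_trans)
qed

theorem odd_map_odd_degree:
  assumes "continuous_map (nsphere m) (nsphere m) f"
    and "\<And>x. x \<in> topspace (nsphere m) \<Longrightarrow> f (\<lambda>i. - x i) = (\<lambda>i. - f x i)"
  shows "odd (Brouwer_degree2 m f)"
  using assms
proof (induction m arbitrary: f)
  case 0
  then show ?case
    by (rule odd_degree_nsphere_0)
next
  case (Suc k)
  define m where "m = Suc k"
  note f = Suc.prems(1)[folded m_def] and odd = Suc.prems(2)[folded m_def]
  let ?S = "topspace (nsphere m)"
  \<comment> \<open>Half the size guaranteed for the largest coordinate of \<open>f x\<close>: an
    error below \<open>d\<close> leaves that coordinate at least \<open>d\<close> along the whole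
    segment from \<open>f x\<close> to \<open>q x\<close>.\<close>
  define d where "d = 1 / (2 * real (Suc m))"
  have "d > 0"
    by (simp add: d_def)
  obtain q L where q: "\<And>i. i \<le> m \<Longrightarrow> continuous_map (nsphere m) euclideanreal (\<lambda>x. q x i)" and "0 \<le> L"
    and lip: "\<And>x y i. \<lbrakk>x \<in> ?S; y \<in> ?S; i \<le> m\<rbrakk> \<Longrightarrow> \<bar>q x i - q y i\<bar> \<le> L * (\<Sum>j\<le>m. \<bar>x j - y j\<bar>)"
    and approx: "\<And>x i. \<lbrakk>x \<in> ?S; i \<le> m\<rbrakk> \<Longrightarrow> \<bar>f x i - q x i\<bar> < d"
    and q_odd: "\<And>x i. q (\<lambda>i. - x i) i = - q x i"
    by (rule nsphere_odd_lipschitz_approximation[OF f odd \<open>d > 0\<close>]) blast+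
  have fS: "f x \<in> ?S" if "x \<in> ?S" for x
    using f that continuous_map_image_subset_topspace by blast
  have fi: "continuous_map (nsphere m) euclideanreal (\<lambda>x. f x i)" for i
    using continuous_map_compose[OF f continuous_map_nsphere_projection[of m i]] by (simp add: o_def)
  have "2 * d = 1 / real (Suc m)"
    unfolding d_def by (simp only: divide_simps) simp
  then have large: "\<exists>i\<le>m. 2 * d \<le> \<bar>f x i\<bar>" if "x \<in> ?S" for x
    using nsphere_large_coordinate[OF fS[OF that]] by simp
  have near: "\<exists>i\<le>m. d \<le> \<bar>(1 - t) * f x i + t * q x i\<bar>" if x: "x \<in> ?S" and t: "0 \<le> t" "t \<le> 1" for x t
  proof -
    obtain i where i: "i \<le> m" "2 * d \<le> \<bar>f x i\<bar>"
      using large[OF x] by blast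
    have "t * \<bar>f x i - q x i\<bar> \<le> 1 * d"
      using approx[OF x i(1)] t by (intro mult_mono) auto
    then have "\<bar>t * (f x i - q x i)\<bar> \<le> d"
      using t by (simp add: abs_mult)
    moreover have "(1 - t) * f x i + t * q x i = f x i - t * (f x i - q x i)"
      by (simp add: algebra_simps)
    ultimately show ?thesis
      using i by (intro exI[of _ i]) linarith
  qed
  have away: "\<exists>i\<le>m. d \<le> \<bar>q x i\<bar>" if "x \<in> ?S" for x
    using near[OF that, of 1] by simp
  have bound: "\<bar>q x i\<bar> \<le> 1 + d" if "x \<in> ?S" "i \<le> m" for x i
    using approx[OF that] nsphere_abs_le_1[OF fS[OF that(1)], of i] by linarith
  obtain p where p: "\<And>i. i \<le> m \<Longrightarrow> 0 < p i"
    and miss: "\<And>x c. \<lbrakk>x \<in> ?S; x m = 0\<rbrakk> \<Longrightarrow> \<exists>i\<le>m. q x i \<noteq> c * p i"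
    using odd_lipschitz_map_misses_line[OF \<open>0 \<le> L\<close> \<open>0 < d\<close> lip bound away q_odd] by blast
  \<comment> \<open>Subtracting the multiple of \<open>p\<close> that cancels coordinate
    \<open>m\<close> sends the line through \<open>p\<close> to the last axis. The factor
    \<open>\<bar>x m\<bar>\<close> is even, so \<open>G\<close> stays odd, and it makes the last
    coordinate vanish on the equator.\<close>
  define G where "G x i = (if i = m then \<bar>x m\<bar> * q x m else q x i - q x m / p m * p i)" for x i
  let ?g = "\<lambda>x. sphere_normalize m (G x)"
  have "Brouwer_degree2 m f = Brouwer_degree2 m (\<lambda>x. sphere_normalize m (f x))"
    by (intro Brouwer_degree2_eq) (simp add: fS sphere_normalize_id)
  also have "\<dots> = Brouwer_degree2 m (\<lambda>x. sphere_normalize m (q x))"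
  proof (intro Brouwer_degree2_homotopic homotopic_with_sphere_normalize fi q)
    show "\<exists>i\<le>m. (1 - t) * f x i + t * q x i \<noteq> 0" if "x \<in> ?S" "0 \<le> t" "t \<le> 1" for x t
      using near[OF that] \<open>d > 0\<close> by fastforce
  qed
  also have hom: "homotopic_with (\<lambda>_. True) (nsphere m) (nsphere m) (\<lambda>x. sphere_normalize m (q x)) ?g"
  proof (intro homotopic_with_sphere_normalize q)
    have "continuous_map (nsphere m) euclideanreal (\<lambda>x. \<bar>x m\<bar> * q x m)"
      by (intro continuous_map_real_mult continuous_map_real_abs continuous_map_nsphere_projection q) simp
    moreover have "continuous_map (nsphere m) euclideanreal (\<lambda>x. q x i - q x m / p m * p i)" if "i \<le> m" for i
      using q that p[of m] by (intro continuous_map_diff continuous_map_real_mult continuous_map_real_divide) auto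
    ultimately show "continuous_map (nsphere m) euclideanreal (\<lambda>x. G x i)" if "i \<le> m" for i
      using that by (cases "i = m") (simp_all add: G_def)
  next
    fix x t assume x: "x \<in> ?S" and t: "0 \<le> t" "t \<le> (1::real)"
    show "\<exists>i\<le>m. (1 - t) * q x i + t * G x i \<noteq> 0"
    proof (rule ccontr)
      assume "\<not> ?thesis"
      then have zero: "(1 - t) * q x i + t * G x i = 0" if "i \<le> m" for i
        using that by blast
      \<comment> \<open>At a zero of the segment, \<open>q x m = 0\<close> would make all of
        \<open>q x\<close> vanish. Otherwise the last coordinate forces \<open>t = 1\<close> and
        \<open>x m = 0\<close>, and then these equations put \<open>q x\<close> on the line through
        \<open>p\<close>, which the equator misses.\<close>
      have other: "q x i = t * (q x m / p m) * p i" if "i \<le> m" "i \<noteq> m" for i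
        using zero[OF that(1)] that by (simp add: G_def algebra_simps)
      have "((1 - t) + t * \<bar>x m\<bar>) * q x m = 0"
        using zero[of m] by (simp add: G_def algebra_simps)
      moreover have "q x m \<noteq> 0"
      proof
        assume "q x m = 0"
        then have "q x i = 0" if "i \<le> m" for i
          using other[of i] that by auto
        then show False
          using away[OF x] \<open>d > 0\<close> by force
      qed
      ultimately have "(1 - t) + t * \<bar>x m\<bar> = 0"
        by simp
      moreover have "0 \<le> t * \<bar>x m\<bar>"
        using t by simp
      ultimately have "t = 1" "x m = 0"
        using t by (auto simp: add_nonneg_eq_0_iff)
      then have "q x i = q x m / p m * p i" if "i \<le> m" for i
        using other[of i] p[of m] that by (cases "i = m") auto
      then show False
        using miss[OF x \<open>x m = 0\<close>] by blast
    qed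
  qed
  \<comment> \<open>The homotopy enters the chain of equalities through the equality of degrees that
    it yields.\<close>
  note Brouwer_degree2_homotopic[OF hom]
  finally have deg: "Brouwer_degree2 m f = Brouwer_degree2 m ?g" .
  have g: "continuous_map (nsphere m) (nsphere m) ?g"
    using homotopic_with_imp_continuous_maps[OF hom] by blast
  have "G (\<lambda>i. - x i) = (\<lambda>i. - G x i)" for x
    by (auto simp: G_def q_odd)
  then have g_odd: "?g (\<lambda>i. - x i) = (\<lambda>i. - ?g x i)" for x
    by (simp add: sphere_normalize_uminus)
  have equator: "nsphere k = subtopology (nsphere m) {x. x m = 0}"
    by (simp add: m_def subtopology_nsphere_equator)
  have gk: "?g \<in> topspace (nsphere k) \<rightarrow> topspace (nsphere k)"
  proof
    fix x assume "x \<in> topspace (nsphere k)"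
    then have "x \<in> ?S" "x m = 0"
      by (auto simp: equator)
    moreover have "?g x \<in> ?S"
      using g \<open>x \<in> ?S\<close> continuous_map_image_subset_topspace by blast
    ultimately show "?g x \<in> topspace (nsphere k)"
      by (simp add: equator sphere_normalize_def G_def)
  qed
  have "continuous_map (nsphere k) (nsphere k) ?g"
    using g gk unfolding equator
    by (intro continuous_map_into_subtopology continuous_map_from_subtopology) auto
  then have "odd (Brouwer_degree2 k ?g)"
    using g_odd by (rule Suc.IH)
  moreover have "even (Brouwer_degree2 m ?g - Brouwer_degree2 (m - Suc 0) ?g)"
    using g gk g_odd by (intro Borsuk_odd_mapping_degree_step) (auto simp: o_def m_def)
  ultimately show ?case
    using deg by (simp add: m_def)
qed

section \<open>The Borsuk-Ulam theorem\<close>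

theorem theorem4p15:
  fixes n :: nat and g :: "(nat \<Rightarrow> real) \<Rightarrow> (nat \<Rightarrow> real)"
  assumes "continuous_map (nsphere n) (Euclidean_space n) g"
  shows "\<exists>t \<in> topspace (nsphere n).
           (\<lambda>i. - t i) \<in> topspace (nsphere n) \<and> g t = g (\<lambda>i. - t i)"
proof (rule ccontr)
  assume "\<not> ?thesis"
  then have ne: "g x \<noteq> g (\<lambda>i. - x i)" if "x \<in> topspace (nsphere n)" for x
    using that by simp
  have g0: "g x i = 0" if "x \<in> topspace (nsphere n)" "n \<le> i" for x i
    using continuous_map_image_subset_topspace[OF assms] that by (auto simp: topspace_Euclidean_space)
  have gi: "continuous_map (nsphere n) euclideanreal (\<lambda>x. g x i)" for i
    using assms by (simp add: Euclidean_space_def continuous_map_in_subtopology continuous_map_componentwise_UNIV)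
  \<comment> \<open>Coordinate \<open>n\<close> of \<open>g\<close> vanishes on the sphere, hence so
    does that of \<open>u\<close>: after normalisation the image lies in the equator.\<close>
  define u where "u x i = g x i - g (\<lambda>i. - x i) i" for x i
  define h where "h x = sphere_normalize n (u x)" for x
  have h: "continuous_map (nsphere n) (nsphere n) h"
    unfolding h_def
  proof (rule continuous_map_sphere_normalize)
    show "continuous_map (nsphere n) euclideanreal (\<lambda>x. u x i)" for i
      unfolding u_def using gi continuous_map_compose[OF continuous_map_nsphere_uminus gi, of i]
      by (intro continuous_map_diff) (auto simp: o_def)
    fix x assume x: "x \<in> topspace (nsphere n)"
    then obtain i where "g x i \<noteq> g (\<lambda>i. - x i) i"
      using ne by blast
    moreover from this have "i < n"
      using g0[of x i] g0[of "\<lambda>i. - x i" i] x by (metis not_less uminus_in_topspace_nsphere)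
    ultimately show "\<exists>i\<le>n. u x i \<noteq> 0"
      by (auto simp: u_def intro!: exI[of _ i])
  qed
  have "u (\<lambda>i. - x i) = (\<lambda>i. - u x i)" for x
    by (simp add: u_def fun_eq_iff)
  then have "odd (Brouwer_degree2 n h)"
    using h by (intro odd_map_odd_degree) (auto simp: h_def sphere_normalize_uminus)
  moreover have "Brouwer_degree2 n h = 0"
  proof (rule Brouwer_degree2_nonsurjective[OF h])
    \<comment> \<open>The pole on the last axis is not attained, because coordinate \<open>n\<close>
      of \<open>h x\<close> is always 0.\<close>
    let ?e = "\<lambda>i. if i = n then 1 else (0::real)"
    have "?e \<in> topspace (nsphere n)"
      by (simp add: topspace_nsphere if_distrib[of "\<lambda>x. x\<^sup>2"] cong: if_cong)
    moreover have "?e \<notin> h ` topspace (nsphere n)"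
    proof
      assume "?e \<in> h ` topspace (nsphere n)"
      then obtain x where "x \<in> topspace (nsphere n)" "?e = h x"
        by blast
      then have "h x n = 0" "h x n = 1"
        using g0[of x n] g0[of "\<lambda>i. - x i" n] by (auto simp: h_def sphere_normalize_def u_def dest: fun_cong[of _ _ n])
      then show False
        by simp
    qed
    ultimately show "h ` topspace (nsphere n) \<noteq> topspace (nsphere n)"
      by blast
  qed
  ultimately show False
    by simp
qed

end
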